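(* Let $K$ be a $k$-dimensional USO and $h\in[k]$ some dimension. Let $P$ be some union of $h$-phases of $K$. Let $U\subset\{0,1\}^k$ be the set of vertices in the upper $h$-facet that are incident to an edge of $P$, and let $L=\{v\oplus h: v\in U\}$ be the set of their neighbors in the lower $h$-facet. Let $K_U$ and $K_L$ be the (oriented) subgraphs induced by $U$ and by $L$, respectively. Then swapping these two subgraphs yields an orientation $K'$ of $Q_k$, and $K'$ is a USO. Here swapping means that $K'$ is the function given by $$K'(v)=\begin{cases}K(v\oplus h) & \text{if } v\in U\cup L,\\ K(v)&\text{otherwise.}\end{cases}$$
   Context: $[k]=\{1,\ldots,k\}$. $Q_k$ is the $k$-dimensional hypercube graph with vertex set $\{0,1\}^k$; $v\oplus i$ denotes the neighbor of $v$ differing from $v$ exactly in coordinate $i$, and $\{v,v\oplus i\}$ is called an $i$-edge. The upper (lower) $h$-facet is the subgraph induced by the vertices $v$ with $v_h=1$ ($v_h=0$). An orientation $O$ of $Q_k$ directs every edge; it is identified with the function $O:\{0,1\}^k\to\{0,1\}^k$ where $O(v)_i=1$ if the edge $\{v,v\oplus i\}$ is directed upwards (from its endpoint in the lower $i$-facet to its endpoint in the upper $i$-facet) and $O(v)_i=0$ if it is directed downwards. Thus a function $O:\{0,1\}^k\to\{0,1\}^k$ is an orientation if and only if $O(v)_i=O(v\oplus i)_i$ for all $v$ and $i$. A face is the subgraph induced by all vertices that agree with a fixed string $f\in\{0,1,*\}^k$ on the non-$*$ positions. $O$ is a Unique Sink Orientation (USO) if every face contains exactly one vertex with no outgoing edges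 inside that face. Phases. Flipping a set of edges means reversing their directions. The $i$-phases of a USO $O$ are the minimal equivalence classes of the set of $i$-edges such that flipping any collection of these classes preserves the USO property; equivalently (by a known result of Schurr) they are the blocks of the unique partition of the set of (undirected) $i$-edges such that, for every set $P$ of $i$-edges, flipping $P$ in $O$ gives a USO if and only if $P$ is a union of blocks. *)

theory Defs
  imports "HOL-Library.Disjoint_Sets"
begin

text \<open>The coordinate set \<open>[k]\<close> is rendered as a finite type \<open>'k\<close> with \<open>CARD('k) = k\<close>. A vertex of
  \<open>Q\<^sub>k\<close> is a function \<open>'k \<Rightarrow> bool\<close>, where \<open>True\<close> stands for 1.\<close>

type_synonym 'k vertex = "'k \<Rightarrow> bool"

definition neighbor :: "'k vertex \<Rightarrow> 'k \<Rightarrow> 'k vertex"  (infixl \<open>\<oplus>\<close> 65)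
  where "v \<oplus> i = v(i := \<not> v i)"

definition edges :: "'k \<Rightarrow> 'k vertex set set"
  where "edges i = {{v, v \<oplus> i} | v. True}"

definition orientation :: "('k vertex \<Rightarrow> 'k vertex) \<Rightarrow> bool"
  where "orientation O' \<longleftrightarrow> (\<forall>v i. O' v i = O' (v \<oplus> i) i)"

text \<open>\<open>O' v i\<close> records whether the \<open>i\<close>-edge at \<open>v\<close> is directed upwards, regardless of which endpoint
  \<open>v\<close> is. Hence this edge leaves \<open>v\<close> if \<open>v\<close> is its lower endpoint and \<open>O' v i\<close> holds, or \<open>v\<close> is its upper
  endpoint and \<open>O' v i\<close> fails.\<close>

definition outgoing :: "('k vertex \<Rightarrow> 'k vertex) \<Rightarrow> 'k vertex \<Rightarrow> 'k \<Rightarrow> bool"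
  where "outgoing O' v i \<longleftrightarrow> (if v i then \<not> O' v i else O' v i)"

text \<open>In a face string, \<open>None\<close> stands for \<open>*\<close>.\<close>

definition face :: "('k \<Rightarrow> bool option) \<Rightarrow> 'k vertex set"
  where "face f = {v. \<forall>i b. f i = Some b \<longrightarrow> v i = b}"

definition sink_in :: "('k vertex \<Rightarrow> 'k vertex) \<Rightarrow> 'k vertex set \<Rightarrow> 'k vertex \<Rightarrow> bool"
  where "sink_in O' F v \<longleftrightarrow> v \<in> F \<and> (\<forall>i. v \<oplus> i \<in> F \<longrightarrow> \<not> outgoing O' v i)"

definition USO :: "('k::finite vertex \<Rightarrow> 'k vertex) \<Rightarrow> bool"
  where "USO O' \<longleftrightarrow> orientation O' \<and> (\<forall>f. \<exists>!v. sink_in O' (face f) v)"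

definition flip_edges ::
    "'k vertex set set \<Rightarrow> ('k vertex \<Rightarrow> 'k vertex) \<Rightarrow> 'k vertex \<Rightarrow> 'k vertex"
  where "flip_edges P O' = (\<lambda>v i. if {v, v \<oplus> i} \<in> P then \<not> O' v i else O' v i)"

definition flippable_partition ::
    "('k::finite vertex \<Rightarrow> 'k vertex) \<Rightarrow> 'k \<Rightarrow> 'k vertex set set set \<Rightarrow> bool"
  where "flippable_partition O' i \<P> \<longleftrightarrow>
    partition_on (edges i) \<P> \<and> (\<forall>\<C>\<subseteq>\<P>. USO (flip_edges (\<Union>\<C>) O'))"

definition phase_partition ::
    "('k::finite vertex \<Rightarrow> 'k vertex) \<Rightarrow> 'k \<Rightarrow> 'k vertex set set set \<Rightarrow> bool"
  where "phase_partition O' i \<P> \<longleftrightarrow> flippable_partition O' i \<P> \<and>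
    (\<forall>\<Q>. flippable_partition O' i \<Q> \<and> refines (edges i) \<Q> \<P> \<longrightarrow> \<Q> = \<P>)"

text \<open>For a USO \<open>O'\<close> a minimal partition exists, as the partition of the \<open>i\<close>-edges into a single block is
  flippable and there are only finitely many partitions. It is unique (Schurr), so the following
  set consists of the blocks of one partition.\<close>

definition phases :: "('k::finite vertex \<Rightarrow> 'k vertex) \<Rightarrow> 'k \<Rightarrow> 'k vertex set set set"
  where "phases O' i = \<Union>{\<P>. phase_partition O' i \<P>}"

end

theory Submission
  imports Defs
begin

text \<open>By the criterion of Szabo and Welzl, an orientation \<open>O\<close> is a USO iff any two distinct vertices
  \<open>v\<close>, \<open>w\<close> differ in a coordinate \<open>j\<close> with \<open>O(v)\<^sub>j = O(w)\<^sub>j\<close>. Let \<open>v\<^sub>h \<noteq> w\<^sub>h\<close>. If \<open>h\<close> is the only such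
  coordinate, then a flip of \<open>h\<close>-edges that preserves the USO property flips the \<open>h\<close>-edges at \<open>v\<close> and
  \<open>w\<close> both or neither. So if a union of phases contains the \<open>h\<close>-edge at \<open>v\<close> but not the one at \<open>w\<close>,
  then there is such a coordinate other than \<open>h\<close>. This is what is needed to compare \<open>K(v \<oplus> h)\<close>
  with \<open>K(w)\<close> when only \<open>v\<close> is affected by the swap.\<close>

section \<open>Faces and the Szabo-Welzl criterion\<close>

lemma neighbor_simps [simp]:
  "(v \<oplus> i) i = (\<not> v i)"
  "j \<noteq> i \<Longrightarrow> (v \<oplus> i) j = v j"
  "v \<oplus> i \<oplus> i = v"
  by (auto simp: neighbor_def)

lemma neighbor_commute: "v \<oplus> i \<oplus> j = v \<oplus> j \<oplus> i"
  by (auto simp: neighbor_def fun_eq_iff)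

lemma neighbor_in_face_iff:
  assumes "v \<in> face f"
  shows "v \<oplus> i \<in> face f \<longleftrightarrow> f i = None"
proof
  show "f i = None" if "v \<oplus> i \<in> face f"
    using assms that neighbor_simps(1)[of v i] unfolding face_def by (cases "f i") blast+
  show "v \<oplus> i \<in> face f" if "f i = None"
    using assms that by (auto simp: face_def neighbor_def)
qed

lemma face_split:
  assumes "f i = None"
  shows "v \<in> face f \<longleftrightarrow> v \<in> face (f(i := Some (v i)))"
  using assms unfolding face_def by (auto split: if_splits) (metis option.distinct(1))+

lemma sink_in_face_iff:
  "sink_in O' (face f) v \<longleftrightarrow> v \<in> face f \<and> (\<forall>i. f i = None \<longrightarrow> \<not> outgoing O' v i)"
  unfolding sink_in_def using neighbor_in_face_iff[of v f] by blast

text \<open>Unique sinks, the case of empty \<open>A\<close>, extend to every outgoing pattern on a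
  face by inserting the coordinates of \<open>A\<close> one by one.\<close>

lemma USO_ex1_outmap:
  fixes A :: "'k::finite set"
  assumes "USO O'"
  shows "\<exists>!v. v \<in> face f \<and> (\<forall>i. f i = None \<longrightarrow> outgoing O' v i = (i \<in> A))"
  using finite[of A]
proof (induction A arbitrary: f rule: finite_induct)
  case empty
  then show ?case
    using assms by (simp add: USO_def sink_in_face_iff)
next
  case (insert a A)
  define Q where
    "Q B g v \<longleftrightarrow> v \<in> face g \<and> (\<forall>i. g i = None \<longrightarrow> outgoing O' v i = (i \<in> B))" for B g v
  have IH: "\<exists>!v. Q A g v" for g
    unfolding Q_def by (rule insert.IH)
  have "\<exists>!v. Q (insert a A) f v"
  proof (cases "f a")
    case (Some b)
    then have "Q (insert a A) f v = Q A f v" for v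
      by (auto simp: Q_def)
    then show ?thesis
      using IH by simp
  next
    case None
    let ?f = "\<lambda>b. f(a := Some b)"
    have split: "Q B f v \<longleftrightarrow> Q B (?f (v a)) v \<and> outgoing O' v a = (a \<in> B)" for B v
      unfolding Q_def using face_split[of f a v, OF None] None by auto
    have same: "Q (insert a A) (?f b) v \<longleftrightarrow> Q A (?f b) v" for b v
      by (auto simp: Q_def)
    have coord: "v a = b" if "Q A (?f b) v" for b v
      using that by (auto simp: Q_def face_def)
    define x where "x b = (THE v. Q A (?f b) v)" for b
    have x: "Q A (?f b) v \<longleftrightarrow> v = x b" for b v
      using theI'[OF IH[of "?f b"]] IH[of "?f b"] unfolding x_def by blast
    have xa: "x b a = b" for b
      using coord x by blast
    \<comment> \<open>Exactly one of the two solutions \<open>x b\<close> in the \<open>a\<close>-facets of the face has no outgoing \<open>a\<close>-edge,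
      so the other one is the unique solution with an outgoing \<open>a\<close>-edge.\<close>
    have "Q A f v \<longleftrightarrow> v = x (v a) \<and> \<not> outgoing O' v a" for v
      using split[of A v] x insert.hyps(2) by simp
    then have "\<exists>!v. v = x (v a) \<and> \<not> outgoing O' v a"
      using IH[of f] by simp
    then have "outgoing O' (x True) a \<longleftrightarrow> \<not> outgoing O' (x False) a"
      by (metis (full_types) xa)
    then have "\<exists>!v. v = x (v a) \<and> outgoing O' v a"
      by (metis (full_types) xa)
    moreover have "Q (insert a A) f v \<longleftrightarrow> v = x (v a) \<and> outgoing O' v a" for v
      using split[of "insert a A" v] same x by simp
    ultimately show ?thesis
      by simp
  qed
  then show ?case
    unfolding Q_def .
qed

lemma outgoing_eq_iff:
  assumes "v j \<noteq> w j"
  shows "outgoing O' v j = outgoing O' w j \<longleftrightarrow> O' v j \<noteq> O' w j"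
  using assms by (auto simp: outgoing_def)

text \<open>Otherwise \<open>v\<close> and \<open>w\<close> would have the same outgoing pattern in
  the smallest face containing both.\<close>

lemma USO_distinct:
  assumes "USO O'" "v \<noteq> w"
  shows "\<exists>j. v j \<noteq> w j \<and> O' v j = O' w j"
proof (rule ccontr)
  assume "\<not> ?thesis"
  then have eq: "outgoing O' v j = outgoing O' w j" if "v j \<noteq> w j" for j
    using that outgoing_eq_iff[of v j w O'] by blast
  \<comment> \<open>The free coordinates of \<open>f\<close> are exactly those in which
    \<open>v\<close> and \<open>w\<close> differ.\<close>
  define f where "f = (\<lambda>j. if v j = w j then Some (v j) else None)"
  have "v \<in> face f" "w \<in> face f"
    by (auto simp: f_def face_def)
  moreover have "\<forall>i. f i = None \<longrightarrow> outgoing O' w i = outgoing O' v i"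
    using eq by (auto simp: f_def)
  ultimately show False
    using USO_ex1_outmap[OF assms(1), of f "{i. outgoing O' v i}"] assms(2) by auto
qed

text \<open>The criterion makes the outgoing pattern injective on each face, hence surjective by
  finiteness; a sink is a preimage of the empty pattern.\<close>

lemma USO_intro:
  fixes O' :: "'k::finite vertex \<Rightarrow> 'k vertex"
  assumes "orientation O'"
    and distinct: "\<And>v w. v \<noteq> w \<Longrightarrow> \<exists>j. v j \<noteq> w j \<and> O' v j = O' w j"
  shows "USO O'"
  unfolding USO_def
proof (intro conjI allI)
  fix f :: "'k \<Rightarrow> bool option"
  have out: "\<exists>j. v j \<noteq> w j \<and> outgoing O' v j \<noteq> outgoing O' w j" if "v \<noteq> w" for v w
    using distinct[OF that] outgoing_eq_iff by metis
  \<comment> \<open>Keeping the fixed coordinates of \<open>v\<close> turns the pattern map of one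
    face into a self-map of the whole cube.\<close>
  define g where "g = (\<lambda>v i. if f i = None then outgoing O' v i else v i)"
  have "inj g"
  proof (rule injI, rule ccontr)
    fix v w assume "g v = g w" "v \<noteq> w"
    with out obtain j where "v j \<noteq> w j" "outgoing O' v j \<noteq> outgoing O' w j"
      by blast
    with \<open>g v = g w\<close> show False
      by (auto simp: g_def fun_eq_iff split: if_splits dest: spec[of _ j])
  qed
  then have "surj g"
    by (simp add: finite_UNIV_inj_surj)
  \<comment> \<open>The target is False on free coordinates and the value prescribed by
    \<open>f\<close> on fixed ones.\<close>
  then obtain v where v: "g v = (\<lambda>i. f i = Some True)"
    by (metis surjD)
  have g_v: "f i = None \<Longrightarrow> \<not> outgoing O' v i" "f i = Some b \<Longrightarrow> v i = b" for i b
    using fun_cong[OF v, of i] by (auto simp: g_def)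
  then have "sink_in O' (face f) v"
    unfolding sink_in_face_iff by (simp add: face_def)
  moreover have "x = y" if "sink_in O' (face f) x" "sink_in O' (face f) y" for x y
  proof (rule ccontr)
    assume "x \<noteq> y"
    with out obtain j where j: "x j \<noteq> y j" "outgoing O' x j \<noteq> outgoing O' y j"
      by blast
    then have "f j = None"
      using that by (cases "f j") (auto simp: sink_in_def face_def)
    with j that show False
      by (auto simp: sink_in_face_iff)
  qed
  ultimately show "\<exists>!v. sink_in O' (face f) v"
    by blast
qed (fact assms(1))

section \<open>Phases and the swap\<close>

lemma edge_of_vertex:
  assumes "e \<in> edges i" "v \<in> e"
  shows "e = {v, v \<oplus> i}"
  using assms by (auto simp: edges_def)

lemma edge_direction:
  assumes "{v, v \<oplus> j} \<in> edges i"
  shows "j = i"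
proof -
  have "{v, v \<oplus> j} = {v, v \<oplus> i}"
    using assms by (intro edge_of_vertex) auto
  then have "v \<oplus> j = v \<oplus> i"
    by (metis doubleton_eq_iff)
  then show ?thesis
    by (metis neighbor_simps(1,2))
qed

text \<open>Only \<open>h\<close> can witness the criterion for \<open>v\<close> and
  \<open>w\<close>, both before and after the flip, so the two \<open>h\<close>-edges must have
  equal directions both times.\<close>

lemma flippable_in_phase:
  assumes "USO O'" "USO (flip_edges B O')" "B \<subseteq> edges h"
    and "v h \<noteq> w h" and phase: "\<And>j. j \<noteq> h \<Longrightarrow> v j \<noteq> w j \<Longrightarrow> O' v j \<noteq> O' w j"
  shows "{v, v \<oplus> h} \<in> B \<longleftrightarrow> {w, w \<oplus> h} \<in> B"
proof -
  have "v \<noteq> w"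
    using \<open>v h \<noteq> w h\<close> by auto
  have flip: "flip_edges B O' x j = O' x j" if "j \<noteq> h" for x j
    using that edge_direction[of x j h] \<open>B \<subseteq> edges h\<close> by (auto simp: flip_edges_def)
  have "O' v h = O' w h"
    using USO_distinct[OF assms(1) \<open>v \<noteq> w\<close>] phase by metis
  moreover have "flip_edges B O' v h = flip_edges B O' w h"
    using USO_distinct[OF assms(2) \<open>v \<noteq> w\<close>] phase flip by metis
  ultimately show ?thesis
    by (auto simp: flip_edges_def split: if_splits)
qed

text \<open>A phase is a block of a flippable partition, and the subfamily consisting of that block
  alone may be flipped.\<close>

lemma phases_flippable:
  assumes "B \<in> phases O' h"
  shows "B \<subseteq> edges h" "USO (flip_edges B O')"
proof -
  obtain \<P> where "flippable_partition O' h \<P>" "B \<in> \<P>"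
    using assms by (auto simp: phases_def phase_partition_def)
  then have "\<Union>\<P> = edges h" "USO (flip_edges (\<Union>{B}) O')"
    unfolding flippable_partition_def partition_on_def by blast+
  with \<open>B \<in> \<P>\<close> show "B \<subseteq> edges h" "USO (flip_edges B O')"
    by auto
qed

text \<open>Here \<open>S\<close> plays the role of \<open>U \<union> L\<close>;
  \<open>closed\<close> is the only information about phases that the swap relies on.\<close>

lemma USO_partial_swap:
  fixes K K' :: "'k::finite vertex \<Rightarrow> 'k vertex"
  assumes "USO K"
    and S_neighbor: "\<And>v. v \<oplus> h \<in> S \<longleftrightarrow> v \<in> S"
    and closed: "\<And>v w. v h \<noteq> w h \<Longrightarrow> (\<And>j. j \<noteq> h \<Longrightarrow> v j \<noteq> w j \<Longrightarrow> K v j \<noteq> K w j) \<Longrightarrow>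
      v \<in> S \<longleftrightarrow> w \<in> S"
  defines "K' \<equiv> \<lambda>v. if v \<in> S then K (v \<oplus> h) else K v"
  shows "USO K'"
proof (rule USO_intro)
  have ori: "K (v \<oplus> i) i = K v i" for v i
    using \<open>USO K\<close> by (simp add: USO_def orientation_def)
  have separated: "\<exists>j. j \<noteq> h \<and> v j \<noteq> w j \<and> K v j = K w j"
    if "v h \<noteq> w h" "v \<in> S \<longleftrightarrow> w \<notin> S" for v w
  proof (rule ccontr)
    assume "\<not> ?thesis"
    then have "v \<in> S \<longleftrightarrow> w \<in> S"
      by (intro closed[of v w, OF that(1)]) blast
    with that(2) show False
      by blast
  qed
  \<comment> \<open>If an \<open>i\<close>-edge with \<open>i \<noteq> h\<close> leaves
    \<open>S\<close>, then \<open>v\<close> and \<open>v \<oplus> i \<oplus> h\<close> differ only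
    in \<open>i\<close> and \<open>h\<close>, so \<open>separated\<close> must yield
    \<open>i\<close>. Thus \<open>K'\<close> is well defined on such edges.\<close>
  have boundary: "K (v \<oplus> h) i = K v i" if "v \<in> S \<longleftrightarrow> v \<oplus> i \<notin> S" for v i
  proof (cases "i = h")
    case True
    then show ?thesis using ori by simp
  next
    case False
    then have "v h \<noteq> (v \<oplus> i \<oplus> h) h"
      by simp
    moreover have "v \<in> S \<longleftrightarrow> v \<oplus> i \<oplus> h \<notin> S"
      using that S_neighbor by blast
    ultimately obtain j where "j \<noteq> h" "v j \<noteq> (v \<oplus> i \<oplus> h) j" and j: "K v j = K (v \<oplus> i \<oplus> h) j"
      using separated by blast
    then have "j = i"
      by (metis neighbor_simps(2))
    then have "K v i = K (v \<oplus> h \<oplus> i) i"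
      using j by (simp add: neighbor_commute)
    then show ?thesis
      using ori by simp
  qed
  show "orientation K'"
    unfolding orientation_def
  proof (intro allI)
    fix v i
    show "K' v i = K' (v \<oplus> i) i"
      using ori[of v i] ori[of "v \<oplus> h" i] boundary[of v i]
      by (auto simp: K'_def neighbor_commute[of v i h])
  qed
  have mixed: "\<exists>j. v j \<noteq> w j \<and> K (v \<oplus> h) j = K w j" if "v \<in> S" "w \<notin> S" for v w
  \<comment> \<open>If \<open>v\<close> and \<open>w\<close> agree in \<open>h\<close>, then
    \<open>v \<oplus> h\<close> and \<open>w\<close> do not, and \<open>separated\<close> applies to
    them. Otherwise \<open>v \<oplus> h\<close> and \<open>w\<close> agree in \<open>h\<close>, so
    the criterion for \<open>K\<close> gives a coordinate other than \<open>h\<close>.\<close>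
  proof (cases "v h = w h")
    case True
    then show ?thesis
      using separated[of "v \<oplus> h" w] S_neighbor[of v] that by fastforce
  next
    case False
    have "v \<oplus> h \<noteq> w"
      using S_neighbor that by blast
    then obtain j where "(v \<oplus> h) j \<noteq> w j" "K (v \<oplus> h) j = K w j"
      using USO_distinct[OF \<open>USO K\<close>] by blast
    with False show ?thesis
      by (cases "j = h") auto
  qed
  show "\<exists>j. v j \<noteq> w j \<and> K' v j = K' w j" if "v \<noteq> w" for v w
  proof (cases "v \<in> S \<longleftrightarrow> w \<in> S")
    case True
    \<comment> \<open>Shifting both vertices along \<open>h\<close> preserves the set of coordinates
      in which they differ.\<close>
    have "v \<oplus> h \<noteq> w \<oplus> h"
      using that by (metis neighbor_simps(3))
    then obtain j where "(v \<oplus> h) j \<noteq> (w \<oplus> h) j" "K (v \<oplus> h) j = K (w \<oplus> h) j"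
      using USO_distinct[OF \<open>USO K\<close>] by blast
    then have "\<exists>j. v j \<noteq> w j \<and> K (v \<oplus> h) j = K (w \<oplus> h) j"
      by (metis neighbor_simps(1,2))
    then show ?thesis
      using True USO_distinct[OF \<open>USO K\<close> that] by (simp add: K'_def)
  next
    case False
    then show ?thesis
      using mixed[of v w] mixed[of w v] by (auto simp: K'_def)
  qed
qed

theorem corollary28:
  fixes K K' :: "'k::finite vertex \<Rightarrow> 'k vertex"
    and h :: 'k
    and \<C> :: "'k vertex set set set"
    and P :: "'k vertex set set"
    and U L :: "'k vertex set"
  assumes "USO K"
    and "\<C> \<subseteq> phases K h" and "P = \<Union>\<C>"
    and "U = {v. v h \<and> (\<exists>e\<in>P. v \<in> e)}"
    and "L = {v \<oplus> h | v. v \<in> U}"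
    and "K' = (\<lambda>v. if v \<in> U \<union> L then K (v \<oplus> h) else K v)"
  shows "orientation K' \<and> USO K'"
proof -
  have "P \<subseteq> edges h"
    using assms(2,3) phases_flippable(1) by blast
  then have "(\<exists>e\<in>P. v \<in> e) \<longleftrightarrow> {v, v \<oplus> h} \<in> P" for v
    using edge_of_vertex[of _ h v] by blast
  then have U: "v \<in> U \<longleftrightarrow> v h \<and> {v, v \<oplus> h} \<in> P" for v
    using assms(4) by simp
  have "v \<in> L \<longleftrightarrow> v \<oplus> h \<in> U" for v
    using assms(5) by simp (metis neighbor_simps(3))
  then have S: "v \<in> U \<union> L \<longleftrightarrow> {v, v \<oplus> h} \<in> P" for v
    using U by (auto simp: insert_commute)
  have "USO K'"
    unfolding assms(6)
  proof (rule USO_partial_swap[OF \<open>USO K\<close>])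
    show "v \<oplus> h \<in> U \<union> L \<longleftrightarrow> v \<in> U \<union> L" for v
      unfolding S by (simp add: insert_commute)
    fix v w
    assume phase: "v h \<noteq> w h" "\<And>j. j \<noteq> h \<Longrightarrow> v j \<noteq> w j \<Longrightarrow> K v j \<noteq> K w j"
    \<comment> \<open>Closedness is checked for each phase \<open>B\<close> and passes to the union
      \<open>P\<close>.\<close>
    have "{v, v \<oplus> h} \<in> B \<longleftrightarrow> {w, w \<oplus> h} \<in> B" if "B \<in> \<C>" for B
    proof -
      have "B \<in> phases K h"
        using that assms(2) by blast
      from flippable_in_phase[OF \<open>USO K\<close> phases_flippable(2,1)[OF this], of v w] phase
      show ?thesis .
    qed
    then show "v \<in> U \<union> L \<longleftrightarrow> w \<in> U \<union> L"
      unfolding S using assms(3) by blast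
  qed
  then show ?thesis
    by (simp add: USO_def)
qed

end
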